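(* Let $X$ be a positive random variable with Laplace transform $\psi(t):=\mathbb{E}\,e^{-tX}$, let $\nu\in\{1,\frac12\}$, and define $$\Psi(x):=\int_0^\infty e^{-xt}\,\psi\bigl(\sqrt2\,t^{3/2}\bigr)\,t^{\nu-1}\,dt,\qquad x>0.$$ Let $m\ge0$ be an integer, and let $\Psi^{(m)}(0):=\lim_{x\searrow0}\Psi^{(m)}(x)$ (possibly infinite). Then $$(-1)^m\Psi^{(m)}(0)=\int_0^\infty\psi\bigl(\sqrt2\,t^{3/2}\bigr)t^{m+\nu-1}\,dt=\frac{2^{1-(m+\nu)/3}}{3}\,\Gamma\Bigl(\frac{2(m+\nu)}{3}\Bigr)\,\mathbb{E}\,X^{-2m/3-2\nu/3},$$ and, for $0<s<m+\nu$, $$(-1)^m\int_0^\infty x^{s-1}\Psi^{(m)}(x)\,dx=\frac{2^{1-(m+\nu-s)/3}}{3}\,\Gamma(s)\,\Gamma\Bigl(\frac{2(m+\nu-s)}{3}\Bigr)\,\mathbb{E}\,X^{-2(m+\nu-s)/3},$$ where all quantities are interpreted in $[0,\infty]$ (so one side is finite if and only if the other is). If the terms in the last identity are finite for all real $s$ with $0<s<m+\nu$, then that identity also holds for all complex $s$ with $0<\operatorname{Re}s<m+\nu$. *)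

theory Defs
  imports "HOL-Probability.Probability"
begin

definition laplace_transform :: "'a measure \<Rightarrow> ('a \<Rightarrow> real) \<Rightarrow> real \<Rightarrow> real" where
  "laplace_transform M X t = (\<integral>\<omega>. exp (- t * X \<omega>) \<partial>M)"

definition Psi_integrand :: "'a measure \<Rightarrow> ('a \<Rightarrow> real) \<Rightarrow> real \<Rightarrow> real \<Rightarrow> real \<Rightarrow> real" where
  "Psi_integrand M X \<nu> x t =
     exp (- x * t) * laplace_transform M X (sqrt 2 * t powr (3/2)) * t powr (\<nu> - 1)"

text \<open>Only the values at \<open>x > 0\<close> are meaningful: for \<open>x \<le> 0\<close> the integral may diverge, in which
  case the Bochner integral is 0 by convention.\<close>

definition Psi :: "'a measure \<Rightarrow> ('a \<Rightarrow> real) \<Rightarrow> real \<Rightarrow> real \<Rightarrow> real" where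
  "Psi M X \<nu> x = (LBINT t:{0<..}. Psi_integrand M X \<nu> x t)"

definition Psi_deriv :: "'a measure \<Rightarrow> ('a \<Rightarrow> real) \<Rightarrow> real \<Rightarrow> nat \<Rightarrow> real \<Rightarrow> real" where
  "Psi_deriv M X \<nu> m = (deriv ^^ m) (Psi M X \<nu>)"

text \<open>The limit is taken in the extended reals, since it may be infinite (of either sign).\<close>

definition Psi_deriv_0 :: "'a measure \<Rightarrow> ('a \<Rightarrow> real) \<Rightarrow> real \<Rightarrow> nat \<Rightarrow> ereal" where
  "Psi_deriv_0 M X \<nu> m = Lim (at_right 0) (\<lambda>x. ereal (Psi_deriv M X \<nu> m x))"

text \<open>
  The two sides of the Mellin transform identity for real \<open>s\<close>, as elements of \<open>[0, \<infinity>]\<close>.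
  The map \<open>ennreal\<close> sends negative reals to 0, so \<open>mellin_lhs\<close> is the intended
  integral only because \<open>(-1) ^ m * Psi_deriv M X \<nu> m x \<ge> 0\<close> for all \<open>x > 0\<close>.
\<close>

definition mellin_lhs :: "'a measure \<Rightarrow> ('a \<Rightarrow> real) \<Rightarrow> real \<Rightarrow> nat \<Rightarrow> real \<Rightarrow> ennreal" where
  "mellin_lhs M X \<nu> m s =
     (\<integral>\<^sup>+x\<in>{0<..}. ennreal ((-1) ^ m * (x powr (s - 1) * Psi_deriv M X \<nu> m x)) \<partial>lborel)"

definition mellin_rhs :: "'a measure \<Rightarrow> ('a \<Rightarrow> real) \<Rightarrow> real \<Rightarrow> nat \<Rightarrow> real \<Rightarrow> ennreal" where
  "mellin_rhs M X \<nu> m s =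
     ennreal (2 powr (1 - (real m + \<nu> - s) / 3) / 3 * Gamma s * Gamma (2 * (real m + \<nu> - s) / 3))
     * (\<integral>\<^sup>+\<omega>. ennreal (X \<omega> powr (- 2 * (real m + \<nu> - s) / 3)) \<partial>M)"

end

theory Submission
  imports Defs
begin

text \<open>
  The function \<open>\<Psi>\<close> is itself a Laplace transform: with \<open>v t = \<psi>(\<surd>2 t\<^sup>3\<^sup>/\<^sup>2) t\<^sup>\<nu>\<^sup>-\<^sup>1\<close> it is the integral of
  \<open>e\<^sup>-\<^sup>x\<^sup>t v t\<close> over \<open>t > 0\<close>. As \<open>0 \<le> \<psi> \<le> 1\<close>, this converges for every \<open>x > 0\<close>, and one may
  differentiate under the integral sign as often as desired
  (\<open>laplace_half_line_higher_deriv\<close>): \<open>(-1)\<^sup>m \<Psi>\<^sup>(\<^sup>m\<^sup>) x\<close> is the integral of \<open>e\<^sup>-\<^sup>x\<^sup>t t\<^sup>m v t\<close>. The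
  integrand is nonnegative and increases as \<open>x\<close> decreases to 0, so monotone convergence gives the
  limit at 0, finite or not (\<open>laplace_half_line_tendsto_0\<close>).

  Both Mellin transforms that occur are instances of one computation. The substitution
  \<open>u = c t\<^sup>p\<close> in the Gamma integral evaluates the integral of \<open>t\<^sup>z\<^sup>-\<^sup>1 exp (- c t\<^sup>p)\<close> over \<open>t > 0\<close> as
  \<open>\<Gamma>(z/p)/p c\<^sup>-\<^sup>z\<^sup>/\<^sup>p\<close> (\<open>Gamma_integral_stretched_exp\<close>). Integrating this over \<open>c = Y \<omega>\<close> with a
  nonnegative weight \<open>w\<close> and exchanging the integrals, the function
  \<open>t \<mapsto> \<integral> w exp (- Y t\<^sup>p)\<close> has Mellin transform \<open>\<Gamma>(z/p)/p \<integral> w Y\<^sup>-\<^sup>z\<^sup>/\<^sup>p\<close>. For real \<open>z\<close> this is Tonelli's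
  theorem and holds in \<open>[0, \<infinity>]\<close> (\<open>nn_integral_mellin_laplace\<close>); for complex \<open>z\<close> it is Fubini's
  theorem, whose hypothesis is the finiteness of the real identity at \<open>Re z\<close>
  (\<open>integral_mellin_laplace\<close>).

  The computation is applied twice. First \<open>\<Psi>\<^sup>(\<^sup>m\<^sup>)\<close> is a mixture of exponentials \<open>e\<^sup>-\<^sup>t\<^sup>x\<close> over \<open>t\<close>, with
  \<open>p = 1\<close>; this turns its Mellin transform at \<open>s\<close> into \<open>\<Gamma>(s)\<close> times the integral of
  \<open>\<psi>(\<surd>2 t\<^sup>3\<^sup>/\<^sup>2) t\<^sup>m\<^sup>+\<^sup>\<nu>\<^sup>-\<^sup>s\<^sup>-\<^sup>1\<close>. Then \<open>\<psi>(\<surd>2 t\<^sup>3\<^sup>/\<^sup>2)\<close> is a mixture of \<open>exp (- \<surd>2 X t\<^sup>3\<^sup>/\<^sup>2)\<close> over the probability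
  space, with \<open>p = 3/2\<close>; this produces the second Gamma factor and the negative moment of \<open>X\<close>
  (\<open>nn_integral_laplace_moment\<close>, \<open>integral_laplace_moment\<close>). The value at 0 uses the second
  step alone, with \<open>s = 0\<close>.
\<close>

section \<open>Mellin transforms of stretched exponentials and their mixtures\<close>

lemma measurable_complex_powr_const [measurable (raw)]:
  fixes z :: complex and f :: "'a \<Rightarrow> real"
  assumes [measurable]: "f \<in> borel_measurable M"
  shows "(\<lambda>x. complex_of_real (f x) powr z) \<in> borel_measurable M"
proof -
  have "complex_of_real (f x) powr z =
      (if f x = 0 then 0
       else exp (z * (of_real (ln \<bar>f x\<bar>) + of_real (if f x < 0 then pi else 0) * \<i>)))" for x
    by (simp add: powr_def Ln_of_real')
  then show ?thesis by simp
qed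

text \<open>
  The substitution \<open>u = c t\<^sup>p\<close> reduces this to the Gamma integral at \<open>z / p\<close>: the Jacobian
  \<open>c p t\<^sup>p\<^sup>-\<^sup>1\<close> times \<open>u\<^sup>z\<^sup>/\<^sup>p\<^sup>-\<^sup>1\<close> is the constant \<open>p c\<^sup>z\<^sup>/\<^sup>p\<close> times \<open>t\<^sup>z\<^sup>-\<^sup>1\<close>.
\<close>

lemma Gamma_integral_stretched_exp:
  fixes z :: complex and c p :: real
  assumes z: "Re z > 0" and c: "c > 0" and p: "p > 0"
  defines "f \<equiv> \<lambda>t::real. complex_of_real t powr (z - 1) * of_real (exp (- c * t powr p))"
  shows "set_integrable lborel {0<..} f"
    and "(CLBINT t:{0<..}. f t) = Gamma (z / p) / p * of_real c powr (- z / p)"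
proof -
  define k where "k = (\<lambda>u::real. complex_of_real u powr (z / p - 1) / of_real (exp u))"
  define g where "g = (\<lambda>t::real. c * t powr p)"
  define h where "h = (\<lambda>t::real. c * p * t powr (p - 1))"
  define C where "C = of_real p * complex_of_real c powr (z / p)"
  have Re: "Re (z / p) > 0" using z p by simp
  have C0: "C \<noteq> 0" using p c by (simp add: C_def)
  have S: "{0<..} \<in> sets (lebesgue :: real measure)" by simp
  have g: "(g has_field_derivative h t) (at t within {0<..})" if "t \<in> {0<..}" for t
    using that unfolding g_def h_def
    by (auto intro!: derivative_eq_intros)
  have inj: "inj_on g {0<..}"
  proof (rule inj_onI)
    fix x y assume "x \<in> {0<..}" "y \<in> {0<..}" "g x = g y"
    then have "(x powr p) powr (1 / p) = (y powr p) powr (1 / p)" "x > 0" "y > 0"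
      using c by (auto simp: g_def)
    then show "x = y" using p by (simp add: powr_powr)
  qed
  have img: "g ` {0<..} = {0<..}"
  proof safe
    fix u :: real assume "u > 0"
    then have "u = g ((u / c) powr (1 / p))" "(u / c) powr (1 / p) > 0"
      using c p by (auto simp: g_def powr_powr)
    then show "u \<in> g ` {0<..}" by blast
  qed (use c in \<open>auto simp: g_def\<close>)
  have eq: "\<bar>h t\<bar> *\<^sub>R k (g t) = C * f t" if "t \<in> {0<..}" for t
  proof -
    have t: "t > 0" using that by simp
    have "complex_of_real (g t) powr (z / p - 1)
        = of_real c powr (z / p - 1) * of_real (t powr p) powr (z / p - 1)"
      unfolding g_def using c t by (simp add: powr_times_real)
    also have "of_real (t powr p) powr (z / p - 1) = of_real t powr (z - of_real p)"
      using t p by (simp add: powr_def Ln_of_real ln_powr left_diff_distrib)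
    also have "complex_of_real c powr (z / p - 1) = of_real c powr (z / p) / of_real c"
      using c by (simp add: powr_diff)
    finally have 1: "complex_of_real (g t) powr (z / p - 1)
        = of_real c powr (z / p) / of_real c * of_real t powr (z - of_real p)" .
    have 2: "of_real t powr (z - of_real p) * complex_of_real (t powr (p - 1)) = of_real t powr (z - 1)"
      using t by (simp add: powr_of_real[symmetric] powr_add[symmetric])
    have "\<bar>h t\<bar> *\<^sub>R k (g t) = of_real (c * p) * of_real (t powr (p - 1)) *
        (of_real c powr (z / p) / of_real c * of_real t powr (z - of_real p)) / of_real (exp (g t))"
      using c p t by (simp add: h_def k_def 1 scaleR_conv_of_real abs_mult)
    also have "\<dots> = C * ((of_real t powr (z - of_real p) * of_real (t powr (p - 1))) / of_real (exp (g t)))"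
      using c by (simp add: C_def)
    also have "\<dots> = C * f t"
      unfolding 2 by (simp add: f_def g_def exp_minus divide_inverse)
    finally show ?thesis .
  qed
  have k: "k absolutely_integrable_on g ` {0<..}"
    unfolding img k_def using absolutely_integrable_Gamma_integral'[OF Re] by simp
  then have "(\<lambda>t. \<bar>h t\<bar> *\<^sub>R k (g t)) absolutely_integrable_on {0<..}"
    using absolutely_integrable_change_of_variables_real[OF S g inj] by blast
  then have "(\<lambda>t. C * f t) absolutely_integrable_on {0<..}"
    by (subst (asm) set_integrable_cong[OF refl refl eq])
  then have "(\<lambda>t. inverse C * (C * f t)) absolutely_integrable_on {0<..}"
    by (rule set_integrable_mult_right) 
  then have F: "f absolutely_integrable_on {0<..}"
    using C0 by (simp add: mult.assoc[symmetric])
  have [measurable]: "f \<in> borel_measurable borel"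
    unfolding f_def by measurable
  show i: "set_integrable lborel {0<..} f"
    using F unfolding set_integrable_def by (subst (asm) integrable_completion) auto
  have "C * integral {0<..} f = integral {0<..} (\<lambda>t. \<bar>h t\<bar> *\<^sub>R k (g t))"
    unfolding integral_mult_right[symmetric] by (rule integral_cong) (simp add: eq)
  also have "\<dots> = integral {0<..} k"
    using has_absolute_integral_change_of_variables_real[OF S g inj, where f = k] k img by auto
  also have "\<dots> = Gamma (z / p)"
    unfolding k_def using Gamma_integral_complex'[OF Re] by (rule integral_unique)
  finally have "integral {0<..} f = Gamma (z / p) / C"
    using C0 by (simp add: field_simps)
  then show "(CLBINT t:{0<..}. f t) = Gamma (z / p) / p * of_real c powr (- z / p)"
    using set_borel_integral_eq_integral(2)[OF i] by (simp add: C_def powr_minus divide_inverse)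
qed


lemma nn_integral_stretched_exp:
  fixes a c p :: real
  assumes a: "a > 0" and c: "c > 0" and p: "p > 0"
  shows "(\<integral>\<^sup>+t\<in>{0<..}. ennreal (t powr (a - 1) * exp (- c * t powr p)) \<partial>lborel)
      = ennreal (Gamma (a / p) / p * c powr (- a / p))"
proof -
  define f where "f = (\<lambda>t::real. indicator {0<..} t * (t powr (a - 1) * exp (- c * t powr p)))"
  have f: "complex_of_real (f t) = indicator {0<..} t *\<^sub>R
      (of_real t powr (of_real a - 1) * of_real (exp (- c * t powr p)))" for t
    by (auto simp: f_def indicator_def powr_of_real[symmetric])
  have a': "Re (of_real a) > 0" using a by simp
  note G = Gamma_integral_stretched_exp[OF a' c p, unfolded set_integrable_def set_lebesgue_integral_def, folded f]
  have "integrable lborel f"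
    using G(1) by (simp only: complex_of_real_integrable_eq)
  then have "(\<integral>\<^sup>+t. ennreal (f t) \<partial>lborel) = ennreal (\<integral>t. f t \<partial>lborel)"
    by (intro nn_integral_eq_integral) (auto simp: f_def)
  moreover have "complex_of_real (\<integral>t. f t \<partial>lborel) = of_real (Gamma (a / p) / p * c powr (- a / p))"
    using G(2) c by (simp add: Gamma_complex_of_real[symmetric] powr_of_real[symmetric])
  moreover have "(\<integral>\<^sup>+t. ennreal (f t) \<partial>lborel)
      = (\<integral>\<^sup>+t\<in>{0<..}. ennreal (t powr (a - 1) * exp (- c * t powr p)) \<partial>lborel)"
    by (intro nn_integral_cong) (auto simp: f_def indicator_def)
  ultimately show ?thesis by (simp only: of_real_eq_iff)
qed

text \<open>
  Tonelli's theorem: the integral over \<open>t\<close> is done first, for fixed \<open>\<omega>\<close>. The weight \<open>w\<close> allows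
  \<open>\<mu>\<close> to be Lebesgue measure with a density supported on the half-line as well as a probability
  measure; \<open>Y\<close> has to be positive only where that weight does not vanish.
\<close>

lemma nn_integral_mellin_laplace:
  fixes w Y :: "'b \<Rightarrow> real" and a p :: real
  assumes "sigma_finite_measure \<mu>"
    and [measurable]: "w \<in> borel_measurable \<mu>" "Y \<in> borel_measurable \<mu>"
    and w: "\<And>\<omega>. w \<omega> \<ge> 0" and Y: "AE \<omega> in \<mu>. w \<omega> \<noteq> 0 \<longrightarrow> Y \<omega> > 0"
    and a: "a > 0" and p: "p > 0"
  shows "(\<integral>\<^sup>+t\<in>{0<..}. ennreal (t powr (a - 1)) *
            (\<integral>\<^sup>+\<omega>. ennreal (w \<omega> * exp (- Y \<omega> * t powr p)) \<partial>\<mu>) \<partial>lborel)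
      = ennreal (Gamma (a / p) / p) * (\<integral>\<^sup>+\<omega>. ennreal (w \<omega> * Y \<omega> powr (- a / p)) \<partial>\<mu>)"
proof -
  interpret sigma_finite_measure \<mu> by fact
  interpret pair_sigma_finite lborel \<mu> ..
  define h where "h = (\<lambda>t \<omega>. ennreal (w \<omega>) *
      (ennreal (t powr (a - 1) * exp (- Y \<omega> * t powr p)) * indicator {0<..} t))"
  have [measurable]: "case_prod h \<in> borel_measurable (lborel \<Otimes>\<^sub>M \<mu>)"
    unfolding h_def by measurable
  have "(\<integral>\<^sup>+t\<in>{0<..}. ennreal (t powr (a - 1)) *
            (\<integral>\<^sup>+\<omega>. ennreal (w \<omega> * exp (- Y \<omega> * t powr p)) \<partial>\<mu>) \<partial>lborel)
      = (\<integral>\<^sup>+t. \<integral>\<^sup>+\<omega>. h t \<omega> \<partial>\<mu> \<partial>lborel)"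
    by (intro nn_integral_cong)
       (auto simp: h_def indicator_def nn_integral_cmult[symmetric] ennreal_mult w mult_ac
             intro!: nn_integral_cong)
  also have "\<dots> = (\<integral>\<^sup>+\<omega>. \<integral>\<^sup>+t. h t \<omega> \<partial>lborel \<partial>\<mu>)"
    by (rule Fubini'[symmetric]) simp
  also have "\<dots> = (\<integral>\<^sup>+\<omega>. ennreal (Gamma (a / p) / p) * ennreal (w \<omega> * Y \<omega> powr (- a / p)) \<partial>\<mu>)"
  proof (rule nn_integral_cong_AE, use Y in eventually_elim)
    case (elim \<omega>)
    show ?case
    proof (cases "w \<omega> = 0")
      case False
      then have "Y \<omega> > 0" using elim by simp
      have "(\<integral>\<^sup>+t. h t \<omega> \<partial>lborel)
          = ennreal (w \<omega>) * ennreal (Gamma (a / p) / p * Y \<omega> powr (- a / p))"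
        unfolding h_def nn_integral_stretched_exp[OF a \<open>Y \<omega> > 0\<close> p, symmetric]
        by (rule nn_integral_cmult) simp
      also have "\<dots> = ennreal (Gamma (a / p) / p) * ennreal (w \<omega> * Y \<omega> powr (- a / p))"
        using a p w[of \<omega>] by (subst (1 2) ennreal_mult[symmetric]) (auto simp: ac_simps)
      finally show ?thesis .
    qed (simp add: h_def)
  qed
  also have "\<dots> = ennreal (Gamma (a / p) / p) * (\<integral>\<^sup>+\<omega>. ennreal (w \<omega> * Y \<omega> powr (- a / p)) \<partial>\<mu>)"
    by (rule nn_integral_cmult) simp
  finally show ?thesis .
qed

text \<open>
  The modulus of the integrand at \<open>z\<close> is the integrand at \<open>Re z\<close>, so the real identity at \<open>Re z\<close>
  supplies the absolute convergence that Fubini's theorem asks for.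
\<close>

lemma integral_mellin_laplace:
  fixes w Y :: "'b \<Rightarrow> real" and z :: complex and p :: real
  assumes "sigma_finite_measure \<mu>"
    and [measurable]: "w \<in> borel_measurable \<mu>" "Y \<in> borel_measurable \<mu>"
    and w: "\<And>\<omega>. w \<omega> \<ge> 0" and Y: "AE \<omega> in \<mu>. w \<omega> \<noteq> 0 \<longrightarrow> Y \<omega> > 0"
    and z: "Re z > 0" and p: "p > 0"
    and fin: "(\<integral>\<^sup>+\<omega>. ennreal (w \<omega> * Y \<omega> powr (- Re z / p)) \<partial>\<mu>) < \<infinity>"
  defines "f \<equiv> \<lambda>t::real. complex_of_real t powr (z - 1) *
              of_real (\<integral>\<omega>. w \<omega> * exp (- Y \<omega> * t powr p) \<partial>\<mu>)"
    and "g \<equiv> \<lambda>\<omega>. complex_of_real (w \<omega>) * of_real (Y \<omega>) powr (- z / p)"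
  shows "set_integrable lborel {0<..} f" "integrable \<mu> g"
    "(CLBINT t:{0<..}. f t) = Gamma (z / p) / p * (\<integral>\<omega>. g \<omega> \<partial>\<mu>)"
proof -
  interpret sigma_finite_measure \<mu> by fact
  interpret pair_sigma_finite lborel \<mu> ..
  define h where "h = (\<lambda>t \<omega>. indicator {0<..} t *\<^sub>R
      (complex_of_real t powr (z - 1) * of_real (w \<omega> * exp (- Y \<omega> * t powr p))))"
  have h_meas [measurable]: "case_prod h \<in> borel_measurable (lborel \<Otimes>\<^sub>M \<mu>)"
    unfolding h_def by measurable
  have norm_h: "ennreal (norm (h t \<omega>)) = ennreal (t powr (Re z - 1)) *
      ennreal (w \<omega> * exp (- Y \<omega> * t powr p)) * indicator {0<..} t" for t \<omega>
    by (auto simp: h_def indicator_def norm_mult norm_powr_real_powr ennreal_mult w abs_mult)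
  have "(\<integral>\<^sup>+x. norm (case_prod h x) \<partial>(lborel \<Otimes>\<^sub>M \<mu>)) = (\<integral>\<^sup>+t. \<integral>\<^sup>+\<omega>. norm (h t \<omega>) \<partial>\<mu> \<partial>lborel)"
    using sigma_finite_measure.nn_integral_fst[OF assms(1), of "\<lambda>x. ennreal (norm (case_prod h x))" lborel] by simp
  also have "\<dots> = (\<integral>\<^sup>+t\<in>{0<..}. ennreal (t powr (Re z - 1)) *
            (\<integral>\<^sup>+\<omega>. ennreal (w \<omega> * exp (- Y \<omega> * t powr p)) \<partial>\<mu>) \<partial>lborel)"
    by (simp add: norm_h nn_integral_cmult nn_integral_multc)
  also have "\<dots> < \<infinity>"
    using fin by (subst nn_integral_mellin_laplace[OF assms(1-5) z p])
                 (auto simp: ennreal_mult_less_top)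
  finally have int: "integrable (lborel \<Otimes>\<^sub>M \<mu>) (case_prod h)"
    by (intro integrableI_bounded) auto
  have h1: "(\<integral>\<omega>. h t \<omega> \<partial>\<mu>) = indicator {0<..} t *\<^sub>R f t" for t
    by (simp only: h_def f_def integral_scaleR_right integral_mult_right_zero integral_complex_of_real)
  have h2: "AE \<omega> in \<mu>. (\<integral>t. h t \<omega> \<partial>lborel) = Gamma (z / p) / p * g \<omega>"
    using Y
  proof eventually_elim
    case (elim \<omega>)
    show ?case
    proof (cases "w \<omega> = 0")
      case False
      then have "Y \<omega> > 0" using elim by simp
      have "(\<integral>t. h t \<omega> \<partial>lborel) = (\<integral>t. of_real (w \<omega>) * (indicator {0<..} t *\<^sub>R
          (complex_of_real t powr (z - 1) * of_real (exp (- Y \<omega> * t powr p)))) \<partial>lborel)"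
        by (intro Bochner_Integration.integral_cong) (auto simp: h_def mult_ac)
      also have "\<dots> = of_real (w \<omega>) * (Gamma (z / p) / p * of_real (Y \<omega>) powr (- z / p))"
        unfolding Gamma_integral_stretched_exp(2)[OF z \<open>Y \<omega> > 0\<close> p, symmetric]
          set_lebesgue_integral_def
        by (rule integral_mult_right_zero)
      also have "\<dots> = Gamma (z / p) / p * g \<omega>"
        by (simp add: g_def)
      finally show ?thesis .
    qed (simp add: h_def g_def)
  qed
  have [measurable]: "g \<in> borel_measurable \<mu>" unfolding g_def by measurable
  show "set_integrable lborel {0<..} f"
    using integrable_fst[OF int] by (simp add: h1 set_integrable_def)
  \<comment> \<open>Fubini yields integrability of a multiple of \<open>g\<close>; the factor can be divided out because \<open>\<Gamma>\<close> has
      no zeros.\<close>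
  have "Re (z / p) > 0" using z p by simp
  then have "z / p \<notin> \<int>\<^sub>\<le>\<^sub>0"
    using nonpos_Ints_subset_nonpos_Reals by (force simp: complex_nonpos_Reals_iff)
  then have "Gamma (z / p) \<noteq> 0"
    by (simp add: Gamma_eq_zero_iff)
  have "integrable \<mu> (\<lambda>\<omega>. Gamma (z / p) / p * g \<omega>)"
    using integrable_snd[OF int] h2
    by (subst integrable_cong_AE[where g="\<lambda>\<omega>. \<integral>t. h t \<omega> \<partial>lborel"]) auto
  then have "integrable \<mu> (\<lambda>\<omega>. p / Gamma (z / p) * (Gamma (z / p) / p * g \<omega>))"
    by (rule integrable_mult_right)
  then show "integrable \<mu> g"
    using p \<open>Gamma (z / p) \<noteq> 0\<close> by simp
  have "(CLBINT t:{0<..}. f t) = (\<integral>t. \<integral>\<omega>. h t \<omega> \<partial>\<mu> \<partial>lborel)"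
    by (simp add: h1 set_lebesgue_integral_def)
  also have "\<dots> = (\<integral>\<omega>. \<integral>t. h t \<omega> \<partial>lborel \<partial>\<mu>)"
    by (rule Fubini_integral[OF int, symmetric])
  also have "\<dots> = (\<integral>\<omega>. Gamma (z / p) / p * g \<omega> \<partial>\<mu>)"
    using h2 by (intro integral_cong_AE) auto
  also have "\<dots> = Gamma (z / p) / p * (\<integral>\<omega>. g \<omega> \<partial>\<mu>)"
    by (rule integral_mult_right_zero)
  finally show "(CLBINT t:{0<..}. f t) = Gamma (z / p) / p * (\<integral>\<omega>. g \<omega> \<partial>\<mu>)" .
qed

section \<open>Laplace transforms of functions on the half-line\<close>

definition laplace_half_line :: "(real \<Rightarrow> real) \<Rightarrow> real \<Rightarrow> real" where
  "laplace_half_line v x = (LBINT t:{0<..}. exp (- x * t) * v t)"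

lemma abs_exp_minus_diff_le:
  fixes a b c :: real
  assumes "c \<le> a" "c \<le> b"
  shows "\<bar>exp (- a) - exp (- b)\<bar> \<le> \<bar>a - b\<bar> * exp (- c)"
proof -
  have *: "exp (- a) - exp (- b) \<le> (b - a) * exp (- c)" if "a \<le> b" "c \<le> a" for a b :: real
  proof -
    have "exp (- a) - exp (- b) = exp (- a) * (1 - exp (- (b - a)))"
      by (simp add: algebra_simps flip: exp_add)
    also have "1 - exp (- (b - a)) \<le> b - a"
      using exp_ge_add_one_self[of "- (b - a)"] by linarith
    then have "exp (- a) * (1 - exp (- (b - a))) \<le> exp (- a) * (b - a)"
      by (rule mult_left_mono) simp
    also have "\<dots> \<le> exp (- c) * (b - a)"
      using that by (intro mult_right_mono) auto
    finally show ?thesis by (simp add: mult.commute)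
  qed
  show ?thesis
  proof (cases "a \<le> b")
    case True
    with *[of a b] assms show ?thesis by simp
  next
    case False
    with *[of b a] assms show ?thesis by (simp add: abs_if)
  qed
qed

context
  fixes v :: "real \<Rightarrow> real"
  assumes v [measurable]: "v \<in> borel_measurable borel"
    and int: "\<And>x. x > 0 \<Longrightarrow> set_integrable lborel {0<..} (\<lambda>t. exp (- x * t) * v t)"
begin

text \<open>
  The factor \<open>t\<close> is absorbed by half of the exponential decay: \<open>t e\<^sup>-\<^sup>x\<^sup>t \<le> (2/x) e\<^sup>-\<^sup>x\<^sup>t\<^sup>/\<^sup>2\<close>.
\<close>

lemma laplace_half_line_integrable_mult:
  assumes x: "x > 0"
  shows "set_integrable lborel {0<..} (\<lambda>t. exp (- x * t) * (t * v t))"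
proof (rule set_integrable_bound)
  show "set_integrable lborel {0<..} (\<lambda>t. 2 / x * (exp (- (x / 2) * t) * v t))"
    using x by (intro set_integrable_mult_right int) auto
  show "set_borel_measurable lborel {0<..} (\<lambda>t. exp (- x * t) * (t * v t))"
    unfolding set_borel_measurable_def by measurable
  show "AE t in lborel. t \<in> {0<..} \<longrightarrow>
      norm (exp (- x * t) * (t * v t)) \<le> norm (2 / x * (exp (- (x / 2) * t) * v t))"
  proof (intro AE_I2 impI)
    fix t :: real assume "t \<in> {0<..}"
    then have t: "t > 0" by simp
    have "(x / 2) * t \<le> exp ((x / 2) * t)"
      using exp_ge_add_one_self[of "(x / 2) * t"] by linarith
    then have "t \<le> 2 / x * exp ((x / 2) * t)"
      using x by (simp add: field_simps)
    then have "t * exp (- x * t) \<le> 2 / x * exp ((x / 2) * t) * exp (- x * t)"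
      by (intro mult_right_mono) auto
    also have "\<dots> = 2 / x * exp (- (x / 2) * t)"
      by (simp flip: exp_add)
    finally have "t * exp (- x * t) * \<bar>v t\<bar> \<le> 2 / x * exp (- (x / 2) * t) * \<bar>v t\<bar>"
      by (rule mult_right_mono) simp
    then show "norm (exp (- x * t) * (t * v t)) \<le> norm (2 / x * (exp (- (x / 2) * t) * v t))"
      using t x by (simp add: abs_mult mult_ac)
  qed
qed

text \<open>
  Dominated convergence for the difference quotients. Restricting the quotients to arguments
  \<open>y > x/2\<close> bounds all of them by the single function \<open>t e\<^sup>-\<^sup>x\<^sup>t\<^sup>/\<^sup>2 \<bar>v t\<bar>\<close>.
\<close>

lemma laplace_half_line_has_derivative:
  assumes x: "x > 0"
  shows "(laplace_half_line v has_real_derivative - laplace_half_line (\<lambda>t. t * v t) x) (at x)"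
proof -
  have "((\<lambda>y. (laplace_half_line v y - laplace_half_line v x) / (y - x))
      \<longlongrightarrow> - laplace_half_line (\<lambda>t. t * v t) x) (at x within {x/2<..})"
    unfolding tendsto_at_iff_sequentially
  proof (intro allI impI)
    fix X :: "nat \<Rightarrow> real" assume "\<forall>i. X i \<in> {x/2<..} - {x}" and lim: "X \<longlonglongrightarrow> x"
    then have X: "X i > x / 2" "X i \<noteq> x" for i by auto
    define q where "q = (\<lambda>i t. (exp (- X i * t) - exp (- x * t)) / (X i - x))"
    have eq: "(laplace_half_line v (X i) - laplace_half_line v x) / (X i - x)
        = (LBINT t:{0<..}. q i t * v t)" for i
    proof -
      have "X i > 0" using X(1)[of i] x by linarith
      then have diff: "(LBINT t:{0<..}. exp (- X i * t) * v t - exp (- x * t) * v t)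
          = laplace_half_line v (X i) - laplace_half_line v x"
        unfolding laplace_half_line_def using x by (intro set_integral_diff(2) int)
      have "q i t * v t = (exp (- X i * t) * v t - exp (- x * t) * v t) / (X i - x)" for t
        by (simp add: q_def left_diff_distrib)
      then show ?thesis
        by (simp only: set_integral_divide_zero diff)
    qed
    have "(\<lambda>i. LBINT t:{0<..}. q i t * v t) \<longlonglongrightarrow> (LBINT t:{0<..}. - (exp (- x * t) * (t * v t)))"
      unfolding set_lebesgue_integral_def
    proof (rule integral_dominated_convergence)
      show "integrable lborel (\<lambda>t. norm (indicator {0<..} t *\<^sub>R (exp (- (x / 2) * t) * (t * v t))))"
        using laplace_half_line_integrable_mult[of "x / 2"] x
        by (intro integrable_norm) (simp add: set_integrable_def)
      show "AE t in lborel. (\<lambda>i. indicator {0<..} t *\<^sub>R (q i t * v t))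
          \<longlonglongrightarrow> indicator {0<..} t *\<^sub>R - (exp (- x * t) * (t * v t))"
      proof (intro AE_I2 tendsto_scaleR tendsto_const)
        fix t :: real
        have "((\<lambda>y. exp (- y * t)) has_real_derivative - (t * exp (- x * t))) (at x)"
          by (auto intro!: derivative_eq_intros)
        then have "(\<lambda>i. q i t) \<longlonglongrightarrow> - (t * exp (- x * t))"
          using lim X(2) unfolding has_field_derivative_iff tendsto_at_iff_sequentially
          by (auto simp: q_def o_def)
        from tendsto_mult_right[OF this, of "v t"]
        show "(\<lambda>i. q i t * v t) \<longlonglongrightarrow> - (exp (- x * t) * (t * v t))"
          by (simp add: mult_ac)
      qed
      show "AE t in lborel. norm (indicator {0<..} t *\<^sub>R (q i t * v t))
          \<le> norm (indicator {0<..} t *\<^sub>R (exp (- (x / 2) * t) * (t * v t)))" for i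
      proof (intro AE_I2)
        fix t :: real
        have "\<bar>q i t\<bar> \<le> t * exp (- (x / 2) * t)" if t: "t > 0"
        proof -
          have "\<bar>exp (- (X i * t)) - exp (- (x * t))\<bar> \<le> \<bar>X i * t - x * t\<bar> * exp (- (x / 2 * t))"
            using X(1)[of i] x t by (intro abs_exp_minus_diff_le mult_right_mono) auto
          also have "\<bar>X i * t - x * t\<bar> = \<bar>X i - x\<bar> * t"
            using t by (simp add: abs_mult flip: left_diff_distrib)
          finally show ?thesis
            using X(2)[of i] by (simp add: q_def abs_divide divide_le_eq mult_ac)
        qed
        then show "norm (indicator {0<..} t *\<^sub>R (q i t * v t))
            \<le> norm (indicator {0<..} t *\<^sub>R (exp (- (x / 2) * t) * (t * v t)))"
          using mult_right_mono[of "\<bar>q i t\<bar>" "t * exp (- (x / 2) * t)" "\<bar>v t\<bar>"]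
          by (auto simp: indicator_def abs_mult mult_ac)
      qed
    qed (unfold q_def, measurable)
    then show "((\<lambda>y. (laplace_half_line v y - laplace_half_line v x) / (y - x)) \<circ> X)
        \<longlonglongrightarrow> - laplace_half_line (\<lambda>t. t * v t) x"
      unfolding o_def eq
      unfolding laplace_half_line_def
        set_integral_uminus[OF laplace_half_line_integrable_mult[OF x]] .
  qed
  then show ?thesis
    using x at_within_open[of x "{x/2<..}"] by (simp add: has_field_derivative_iff)
qed

end

lemma laplace_half_line_integrable_power:
  fixes v :: "real \<Rightarrow> real"
  assumes [measurable]: "v \<in> borel_measurable borel"
    and int: "\<And>x. x > 0 \<Longrightarrow> set_integrable lborel {0<..} (\<lambda>t. exp (- x * t) * v t)"
    and x: "x > 0"
  shows "set_integrable lborel {0<..} (\<lambda>t. exp (- x * t) * (t ^ k * v t))"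
  using x
proof (induction k arbitrary: x)
  case (Suc k)
  have "set_integrable lborel {0<..} (\<lambda>t. exp (- x * t) * (t * (t ^ k * v t)))"
    using Suc by (intro laplace_half_line_integrable_mult[of "\<lambda>t. t ^ k * v t"]) simp_all
  then show ?case by (simp add: mult.assoc)
qed (use int in simp)

lemma laplace_half_line_higher_deriv:
  fixes v :: "real \<Rightarrow> real"
  assumes v [measurable]: "v \<in> borel_measurable borel"
    and int: "\<And>x. x > 0 \<Longrightarrow> set_integrable lborel {0<..} (\<lambda>t. exp (- x * t) * v t)"
    and x: "x > 0"
  shows "(deriv ^^ k) (laplace_half_line v) x = (-1) ^ k * laplace_half_line (\<lambda>t. t ^ k * v t) x"
    and "(deriv ^^ k) (laplace_half_line v) differentiable at x"
proof -
  define D where "D = (\<lambda>k x. (-1) ^ k * laplace_half_line (\<lambda>t. t ^ k * v t) x)"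
  have D: "(D k has_real_derivative D (Suc k) x) (at x)" if "x > 0" for k x
  proof -
    have "(laplace_half_line (\<lambda>t. t ^ k * v t) has_real_derivative
        - laplace_half_line (\<lambda>t. t * (t ^ k * v t)) x) (at x)"
      using laplace_half_line_integrable_power[OF v int] that
      by (intro laplace_half_line_has_derivative) auto
    then show ?thesis
      unfolding D_def by (auto intro!: derivative_eq_intros simp: mult_ac)
  qed
  \<comment> \<open>The induction hypothesis has to hold on all of \<open>(0, \<infinity>)\<close>, not just at \<open>x\<close>: \<open>deriv\<close> depends on
      the values near \<open>x\<close>.\<close>
  have step: "((deriv ^^ k) (laplace_half_line v) has_real_derivative D (Suc k) x) (at x)"
    if "\<And>y. y > 0 \<Longrightarrow> (deriv ^^ k) (laplace_half_line v) y = D k y" "x > 0" for k x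
    using D[OF \<open>x > 0\<close>, of k] open_greaterThan
    by (rule has_field_derivative_transform_within_open) (use that in auto)
  have eq: "(deriv ^^ k) (laplace_half_line v) x = D k x" if "x > 0" for k x
    using that
  proof (induction k arbitrary: x)
    case (Suc k)
    then show ?case using step[of k x] by (simp add: DERIV_imp_deriv)
  qed (simp add: D_def)
  show "(deriv ^^ k) (laplace_half_line v) x = (-1) ^ k * laplace_half_line (\<lambda>t. t ^ k * v t) x"
    using eq[OF x] by (simp add: D_def)
  show "(deriv ^^ k) (laplace_half_line v) differentiable at x"
    using step[OF eq x] by (auto simp: real_differentiable_def)
qed

lemma ennreal_laplace_half_line:
  assumes "\<And>t. t > 0 \<Longrightarrow> v t \<ge> 0"
    and "set_integrable lborel {0<..} (\<lambda>t. exp (- x * t) * v t)"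
  shows "ennreal (laplace_half_line v x) = (\<integral>\<^sup>+t\<in>{0<..}. ennreal (exp (- x * t) * v t) \<partial>lborel)"
proof -
  have "(\<integral>\<^sup>+t\<in>{0<..}. ennreal (exp (- x * t) * v t) \<partial>lborel)
      = (\<integral>\<^sup>+t. ennreal (indicator {0<..} t *\<^sub>R (exp (- x * t) * v t)) \<partial>lborel)"
    by (intro nn_integral_cong) (simp add: indicator_def)
  also have "\<dots> = ennreal (laplace_half_line v x)"
    unfolding laplace_half_line_def set_lebesgue_integral_def
    using assms by (intro nn_integral_eq_integral) (auto simp: set_integrable_def indicator_def)
  finally show ?thesis ..
qed

text \<open>
  As \<open>x\<close> decreases to 0, the factor \<open>e\<^sup>-\<^sup>x\<^sup>t\<close> increases to 1, so monotone convergence applies; the limit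
  is infinite exactly when \<open>v\<close> is not integrable.
\<close>

lemma laplace_half_line_tendsto_0:
  assumes [measurable]: "v \<in> borel_measurable borel"
    and v: "\<And>t. t > 0 \<Longrightarrow> v t \<ge> 0"
    and int: "\<And>x. x > 0 \<Longrightarrow> set_integrable lborel {0<..} (\<lambda>t. exp (- x * t) * v t)"
  shows "((\<lambda>x. ennreal (laplace_half_line v x)) \<longlongrightarrow> (\<integral>\<^sup>+t\<in>{0<..}. ennreal (v t) \<partial>lborel)) (at_right 0)"
proof (rule tendsto_at_right_sequentially[where b = 1])
  fix S :: "nat \<Rightarrow> real"
  assume S: "\<And>n. 0 < S n" "\<And>n. S n < 1" "decseq S" "S \<longlonglongrightarrow> 0"
  have "(\<lambda>n. \<integral>\<^sup>+t\<in>{0<..}. ennreal (exp (- S n * t) * v t) \<partial>lborel)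
      \<longlonglongrightarrow> (\<integral>\<^sup>+t\<in>{0<..}. ennreal (v t) \<partial>lborel)"
  proof (rule nn_integral_LIMSEQ)
    show "incseq (\<lambda>n t. ennreal (exp (- S n * t) * v t) * indicator {0<..} t)"
      using v decseqD[OF S(3)]
      by (auto simp: incseq_def le_fun_def indicator_def intro!: ennreal_leI mult_right_mono)
    show "(\<lambda>n. ennreal (exp (- S n * t) * v t) * indicator {0<..} t)
        \<longlonglongrightarrow> ennreal (v t) * indicator {0<..} t" for t
    proof (cases "t > 0")
      case True
      have "(\<lambda>n. exp (- S n * t) * v t) \<longlonglongrightarrow> exp (- 0 * t) * v t"
        by (intro tendsto_intros S)
      with True show ?thesis by (simp add: tendsto_ennrealI)
    qed simp
  qed measurable
  then show "(\<lambda>n. ennreal (laplace_half_line v (S n))) \<longlonglongrightarrow> (\<integral>\<^sup>+t\<in>{0<..}. ennreal (v t) \<partial>lborel)"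
    using S(1) v int by (simp add: ennreal_laplace_half_line)
qed simp

section \<open>Moments of the Laplace transform along the three-halves power\<close>

lemma laplace_transform_measurable [measurable]:
  assumes "prob_space M" and [measurable]: "X \<in> borel_measurable M"
  shows "laplace_transform M X \<in> borel_measurable borel"
proof -
  interpret prob_space M by fact
  show ?thesis unfolding laplace_transform_def by measurable
qed

lemma laplace_transform_bounds:
  assumes "prob_space M" and [measurable]: "X \<in> borel_measurable M"
    and pos: "AE \<omega> in M. X \<omega> > 0" and u: "u \<ge> 0"
  shows "0 \<le> laplace_transform M X u" "laplace_transform M X u \<le> 1"
    "ennreal (laplace_transform M X u) = (\<integral>\<^sup>+\<omega>. ennreal (exp (- u * X \<omega>)) \<partial>M)"
proof -
  interpret prob_space M by fact
  have le: "AE \<omega> in M. exp (- u * X \<omega>) \<le> 1"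
    using pos by eventually_elim (use u in simp)
  have int: "integrable M (\<lambda>\<omega>. exp (- u * X \<omega>))"
    using le by (intro integrable_const_bound[where B = 1]) auto
  show "0 \<le> laplace_transform M X u"
    by (simp add: laplace_transform_def)
  show "laplace_transform M X u \<le> 1"
    using integral_mono_AE[OF int _ le] by (simp add: laplace_transform_def prob_space)
  show "ennreal (laplace_transform M X u) = (\<integral>\<^sup>+\<omega>. ennreal (exp (- u * X \<omega>)) \<partial>M)"
    unfolding laplace_transform_def using int by (intro nn_integral_eq_integral[symmetric]) auto
qed

text \<open>
  On \<open>(0, \<infinity>)\<close> the integrand is dominated by that of the Gamma integral with exponent \<open>a\<close>; this is
  what makes \<open>\<Psi>\<close> finite at every \<open>x > 0\<close>, whatever the law of \<open>X\<close>.
\<close>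

lemma set_integrable_exp_mult_bounded:
  fixes g :: "real \<Rightarrow> real"
  assumes [measurable]: "g \<in> borel_measurable borel"
    and g: "\<And>t. t > 0 \<Longrightarrow> \<bar>g t\<bar> \<le> 1" and x: "x > 0" and a: "a > 0"
  shows "set_integrable lborel {0<..} (\<lambda>t. exp (- x * t) * (g t * t powr (a - 1)))"
  unfolding set_integrable_def
proof (rule integrableI_bounded)
  have "(\<integral>\<^sup>+t. norm (indicator {0<..} t *\<^sub>R (exp (- x * t) * (g t * t powr (a - 1)))) \<partial>lborel)
      \<le> (\<integral>\<^sup>+t\<in>{0<..}. ennreal (t powr (a - 1) * exp (- x * t powr 1)) \<partial>lborel)"
  proof (rule nn_integral_mono)
    fix t :: real
    have "\<bar>g t\<bar> * (t powr (a - 1) * exp (- x * t)) \<le> 1 * (t powr (a - 1) * exp (- x * t))" if "t > 0"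
      using g[OF that] by (intro mult_right_mono) auto
    then show "ennreal (norm (indicator {0<..} t *\<^sub>R (exp (- x * t) * (g t * t powr (a - 1)))))
        \<le> ennreal (t powr (a - 1) * exp (- x * t powr 1)) * indicator {0<..} t"
      by (auto simp: indicator_def abs_mult mult_ac intro!: ennreal_leI)
  qed
  also have "\<dots> < \<infinity>"
    using nn_integral_stretched_exp[OF a x zero_less_one] by simp
  finally show "(\<integral>\<^sup>+t. norm (indicator {0<..} t *\<^sub>R (exp (- x * t) * (g t * t powr (a - 1)))) \<partial>lborel) < \<infinity>" .
qed measurable

text \<open>
  The value \<open>\<psi>(\<surd>2 t\<^sup>3\<^sup>/\<^sup>2)\<close> is the expectation of \<open>exp (- \<surd>2 X t\<^sup>3\<^sup>/\<^sup>2)\<close>, so its Mellin transform is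
  the case \<open>p = 3/2\<close>, \<open>Y = \<surd>2 X\<close>, \<open>w = 1\<close> of the transform of a mixture. The factor
  \<open>(2/3) (\<surd>2)\<^sup>-\<^sup>2\<^sup>a\<^sup>/\<^sup>3\<close> equals \<open>2\<^sup>1\<^sup>-\<^sup>a\<^sup>/\<^sup>3/3\<close>.
\<close>

lemma nn_integral_laplace_moment:
  assumes M: "prob_space M" and X [measurable]: "X \<in> borel_measurable M"
    and pos: "AE \<omega> in M. X \<omega> > 0" and a: "a > 0"
  shows "(\<integral>\<^sup>+t\<in>{0<..}. ennreal (laplace_transform M X (sqrt 2 * t powr (3/2)) * t powr (a - 1)) \<partial>lborel)
      = ennreal (2 powr (1 - a / 3) / 3 * Gamma (2 * a / 3)) *
        (\<integral>\<^sup>+\<omega>. ennreal (X \<omega> powr (- 2 * a / 3)) \<partial>M)"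
proof -
  interpret prob_space M by fact
  have "(\<integral>\<^sup>+t\<in>{0<..}. ennreal (laplace_transform M X (sqrt 2 * t powr (3/2)) * t powr (a - 1)) \<partial>lborel)
      = (\<integral>\<^sup>+t\<in>{0<..}. ennreal (t powr (a - 1)) *
          (\<integral>\<^sup>+\<omega>. ennreal (1 * exp (- (sqrt 2 * X \<omega>) * t powr (3/2))) \<partial>M) \<partial>lborel)"
  proof (rule nn_integral_cong)
    fix t :: real
    have "ennreal (laplace_transform M X (sqrt 2 * t powr (3/2)) * t powr (a - 1))
      = ennreal (t powr (a - 1)) * ennreal (laplace_transform M X (sqrt 2 * t powr (3/2)))"
      by (simp add: ennreal_mult' mult.commute)
    then show "ennreal (laplace_transform M X (sqrt 2 * t powr (3/2)) * t powr (a - 1)) * indicator {0<..} t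
      = ennreal (t powr (a - 1)) *
          (\<integral>\<^sup>+\<omega>. ennreal (1 * exp (- (sqrt 2 * X \<omega>) * t powr (3/2))) \<partial>M) * indicator {0<..} t"
      by (simp add: laplace_transform_bounds(3)[OF M X pos] mult_ac)
  qed
  also have "\<dots> = ennreal (Gamma (a / (3/2)) / (3/2)) *
      (\<integral>\<^sup>+\<omega>. ennreal (1 * (sqrt 2 * X \<omega>) powr (- a / (3/2))) \<partial>M)"
    using pos a by (intro nn_integral_mellin_laplace sigma_finite_measure_axioms) auto
  also have "(\<integral>\<^sup>+\<omega>. ennreal (1 * (sqrt 2 * X \<omega>) powr (- a / (3/2))) \<partial>M)
      = (\<integral>\<^sup>+\<omega>. ennreal (2 powr (- a / 3)) * ennreal (X \<omega> powr (- 2 * a / 3)) \<partial>M)"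
  proof (rule nn_integral_cong_AE, use pos in eventually_elim)
    fix \<omega> assume "X \<omega> > 0"
    moreover have "sqrt 2 powr (- a / (3/2)) = 2 powr (- a / 3)"
      by (simp add: powr_powr flip: powr_half_sqrt)
    ultimately show "ennreal (1 * (sqrt 2 * X \<omega>) powr (- a / (3/2)))
        = ennreal (2 powr (- a / 3)) * ennreal (X \<omega> powr (- 2 * a / 3))"
      by (simp add: powr_mult ennreal_mult' mult.commute)
  qed
  also have "\<dots> = ennreal (2 powr (- a / 3)) * (\<integral>\<^sup>+\<omega>. ennreal (X \<omega> powr (- 2 * a / 3)) \<partial>M)"
    by (rule nn_integral_cmult) simp
  also have "ennreal (Gamma (a / (3/2)) / (3/2)) * (ennreal (2 powr (- a / 3)) *
        (\<integral>\<^sup>+\<omega>. ennreal (X \<omega> powr (- 2 * a / 3)) \<partial>M))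
      = ennreal (2 powr (1 - a / 3) / 3 * Gamma (2 * a / 3)) *
        (\<integral>\<^sup>+\<omega>. ennreal (X \<omega> powr (- 2 * a / 3)) \<partial>M)"
  proof -
    have "2 powr (1 - a / 3) = 2 * 2 powr (- a / 3)"
      using powr_add[of 2 1 "- a / 3"] by simp
    then have eq: "Gamma (a / (3/2)) / (3/2) * 2 powr (- a / 3) = 2 powr (1 - a / 3) / 3 * Gamma (2 * a / 3)"
      by (simp add: mult.commute)
    have "ennreal (Gamma (a / (3/2)) / (3/2)) * ennreal (2 powr (- a / 3))
        = ennreal (2 powr (1 - a / 3) / 3 * Gamma (2 * a / 3))"
      unfolding eq[symmetric] by (rule ennreal_mult''[symmetric]) simp
    then show ?thesis
      by (simp only: mult.assoc[symmetric])
  qed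
  finally show ?thesis .
qed

text \<open>
  The complex exponent only needs the negative moment of order \<open>2 Re z / 3\<close> to be finite, since the
  modulus of \<open>X\<close> raised to a complex power depends on the real part of the exponent alone.
\<close>

lemma integral_laplace_moment:
  fixes z :: complex
  assumes M: "prob_space M" and X [measurable]: "X \<in> borel_measurable M"
    and pos: "AE \<omega> in M. X \<omega> > 0" and z: "Re z > 0"
    and fin: "(\<integral>\<^sup>+\<omega>. ennreal (X \<omega> powr (- 2 * Re z / 3)) \<partial>M) < \<infinity>"
  shows "integrable M (\<lambda>\<omega>. complex_of_real (X \<omega>) powr (- 2 * z / 3))"
    and "(CLBINT t:{0<..}. of_real t powr (z - 1) *
            of_real (laplace_transform M X (sqrt 2 * t powr (3/2))))
      = 2 powr (1 - z / 3) / 3 * Gamma (2 * z / 3) *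
        (\<integral>\<omega>. complex_of_real (X \<omega>) powr (- 2 * z / 3) \<partial>M)"
proof -
  interpret prob_space M by fact
  have const: "(2::complex) powr (1 - z / 3) = 2 * 2 powr (- z / 3)"
    using powr_add[of "2::complex" 1 "- z / 3"] by simp
  let ?c = "complex_of_real (sqrt 2) powr (- z / (3/2))"
  have split: "AE \<omega> in M. complex_of_real 1 * of_real (sqrt 2 * X \<omega>) powr (- z / complex_of_real (3/2))
      = ?c * of_real (X \<omega>) powr (- 2 * z / 3)"
    using pos by eventually_elim (simp add: powr_times_real mult.commute)
  have "(\<integral>\<^sup>+\<omega>. ennreal (1 * (sqrt 2 * X \<omega>) powr (- Re z / (3/2))) \<partial>M)
      = (\<integral>\<^sup>+\<omega>. ennreal (sqrt 2 powr (- Re z / (3/2))) * ennreal (X \<omega> powr (- 2 * Re z / 3)) \<partial>M)"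
    by (rule nn_integral_cong_AE, use pos in eventually_elim)
       (simp add: powr_mult ennreal_mult' mult.commute)
  also have "\<dots> < \<infinity>"
    using fin by (simp add: nn_integral_cmult ennreal_mult_less_top)
  finally have fin': "(\<integral>\<^sup>+\<omega>. ennreal (1 * (sqrt 2 * X \<omega>) powr (- Re z / (3/2))) \<partial>M) < \<infinity>" .
  have pos': "AE \<omega> in M. (1::real) \<noteq> 0 \<longrightarrow> sqrt 2 * X \<omega> > 0"
    using pos by eventually_elim simp
  note mellin_X = integral_mellin_laplace[OF sigma_finite_measure_axioms borel_measurable_const _
      zero_le_one pos' z _ fin']
  have "integrable M (\<lambda>\<omega>. ?c * of_real (X \<omega>) powr (- 2 * z / 3))"
    using mellin_X(2) split by (subst integrable_cong_AE[symmetric]) auto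
  then have "integrable M (\<lambda>\<omega>. inverse ?c * (?c * of_real (X \<omega>) powr (- 2 * z / 3)))"
    by (rule integrable_mult_right)
  then show "integrable M (\<lambda>\<omega>. complex_of_real (X \<omega>) powr (- 2 * z / 3))"
    by (simp flip: mult.assoc)
  have "(CLBINT t:{0<..}. of_real t powr (z - 1) * of_real (laplace_transform M X (sqrt 2 * t powr (3/2))))
      = Gamma (z / of_real (3/2)) / of_real (3/2) *
        (\<integral>\<omega>. complex_of_real 1 * of_real (sqrt 2 * X \<omega>) powr (- z / complex_of_real (3/2)) \<partial>M)"
    using mellin_X(3) by (simp add: laplace_transform_def mult_ac)
  also have "(\<integral>\<omega>. complex_of_real 1 * of_real (sqrt 2 * X \<omega>) powr (- z / complex_of_real (3/2)) \<partial>M)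
      = (\<integral>\<omega>. ?c * of_real (X \<omega>) powr (- 2 * z / 3) \<partial>M)"
    by (rule integral_cong_AE[OF _ _ split]; measurable)
  also have "\<dots> = ?c * (\<integral>\<omega>. of_real (X \<omega>) powr (- 2 * z / 3) \<partial>M)"
    by (rule integral_mult_right_zero)
  also have "?c = 2 powr (- z / 3)"
  proof -
    have sqrt: "Ln (complex_of_real (sqrt 2)) = of_real (ln 2) / 2"
      by (subst Ln_of_real) (simp_all add: ln_sqrt)
    have "Ln (2::complex) = of_real (ln 2)"
      using Ln_of_real[of 2] by simp
    then show ?thesis by (simp add: powr_def sqrt)
  qed
  finally show "(CLBINT t:{0<..}. of_real t powr (z - 1) *
            of_real (laplace_transform M X (sqrt 2 * t powr (3/2))))
      = 2 powr (1 - z / 3) / 3 * Gamma (2 * z / 3) *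
        (\<integral>\<omega>. complex_of_real (X \<omega>) powr (- 2 * z / 3) \<partial>M)"
    unfolding const by (simp add: mult.commute)
qed

section \<open>The function \<open>\<Psi>\<close>, its derivatives and their Mellin transforms\<close>

theorem mainTheorem7:
  fixes M :: "'a measure" and X :: "'a \<Rightarrow> real" and \<nu> :: real and m :: nat
  assumes "prob_space M"
    and "X \<in> borel_measurable M"
    and "AE \<omega> in M. X \<omega> > 0"
    and "\<nu> \<in> {1, 1/2}"
  shows
    \<comment> \<open>the objects in the identities are well defined\<close>
    "(\<forall>x>0. set_integrable lborel {0<..} (Psi_integrand M X \<nu> x))
   \<and> (\<forall>k<m. \<forall>x>0. Psi_deriv M X \<nu> k differentiable at x)
   \<and> (\<forall>x>0. (-1) ^ m * Psi_deriv M X \<nu> m x \<ge> 0)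
   \<and> ((\<lambda>x. ereal (Psi_deriv M X \<nu> m x)) \<longlongrightarrow> Psi_deriv_0 M X \<nu> m) (at_right 0)
   \<and> (-1) ^ m * Psi_deriv_0 M X \<nu> m
       = enn2ereal (\<integral>\<^sup>+t\<in>{0<..}. ennreal (laplace_transform M X (sqrt 2 * t powr (3/2))
                                          * t powr (real m + \<nu> - 1)) \<partial>lborel)
   \<and> (\<integral>\<^sup>+t\<in>{0<..}. ennreal (laplace_transform M X (sqrt 2 * t powr (3/2))
                             * t powr (real m + \<nu> - 1)) \<partial>lborel)
       = ennreal (2 powr (1 - (real m + \<nu>) / 3) / 3 * Gamma (2 * (real m + \<nu>) / 3))
         * (\<integral>\<^sup>+\<omega>. ennreal (X \<omega> powr (- 2 * real m / 3 - 2 * \<nu> / 3)) \<partial>M)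
   \<and> (\<forall>s. 0 < s \<and> s < real m + \<nu> \<longrightarrow> mellin_lhs M X \<nu> m s = mellin_rhs M X \<nu> m s)
   \<and> ((\<forall>s. 0 < s \<and> s < real m + \<nu> \<longrightarrow> mellin_lhs M X \<nu> m s < \<infinity> \<and> mellin_rhs M X \<nu> m s < \<infinity>) \<longrightarrow>
       (\<forall>s::complex. 0 < Re s \<and> Re s < real m + \<nu> \<longrightarrow>
          set_integrable lborel {0<..}
            (\<lambda>x. complex_of_real x powr (s - 1) * complex_of_real (Psi_deriv M X \<nu> m x))
        \<and> integrable M
            (\<lambda>\<omega>. complex_of_real (X \<omega>) powr (- 2 * (of_nat m + of_real \<nu> - s) / 3))
        \<and> (-1) ^ m * (CLBINT x:{0<..}.
              complex_of_real x powr (s - 1) * complex_of_real (Psi_deriv M X \<nu> m x))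
          = 2 powr (1 - (of_nat m + of_real \<nu> - s) / 3) / 3
            * Gamma s * Gamma (2 * (of_nat m + of_real \<nu> - s) / 3)
            * (\<integral>\<omega>. complex_of_real (X \<omega>) powr (- 2 * (of_nat m + of_real \<nu> - s) / 3) \<partial>M)))"
proof -
  interpret prob_space M by fact
  note M = \<open>prob_space M\<close> and X [measurable] = \<open>X \<in> borel_measurable M\<close>
    and pos = \<open>AE \<omega> in M. X \<omega> > 0\<close>
  have \<nu>: "\<nu> > 0" using \<open>\<nu> \<in> {1, 1/2}\<close> by auto
  define g where "g = (\<lambda>t. laplace_transform M X (sqrt 2 * t powr (3/2)))"
  define v where "v = (\<lambda>t. g t * t powr (\<nu> - 1))"
  define w where "w = (\<lambda>t. indicator {0<..} t * (t ^ m * v t))"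
  \<comment> \<open>Up to sign, the \<open>m\<close>-th derivative of \<open>\<Psi>\<close> is the mixture of the exponentials \<open>e\<^sup>-\<^sup>t\<^sup>x\<close> with weight
      \<open>w t\<close>; the value at 0 and both Mellin transforms are expressed through the moments \<open>J a\<close>.\<close>
  define J where "J = (\<lambda>a. \<integral>\<^sup>+t\<in>{0<..}. ennreal (g t * t powr (a - 1)) \<partial>lborel)"
  have [measurable]: "laplace_transform M X \<in> borel_measurable borel"
    by (rule laplace_transform_measurable[OF M X])
  have g_meas [measurable]: "g \<in> borel_measurable borel" unfolding g_def by measurable
  have v_meas [measurable]: "v \<in> borel_measurable borel" unfolding v_def by measurable
  have w_meas [measurable]: "w \<in> borel_measurable borel" unfolding w_def by measurable
  have g01: "0 \<le> g t" "g t \<le> 1" for t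
    unfolding g_def by (rule laplace_transform_bounds[OF M X pos]; simp)+
  have w0: "w t \<ge> 0" and wpos: "w t \<noteq> 0 \<longrightarrow> t > 0" for t
    using g01[of t] by (auto simp: w_def v_def indicator_def)
  have w_powr: "w t * t powr b = indicator {0<..} t * (g t * t powr (real m + \<nu> + b - 1))" for t b
    by (auto simp: w_def v_def indicator_def powr_add[symmetric] algebra_simps simp flip: powr_realpow)

  have int_v: "set_integrable lborel {0<..} (\<lambda>t. exp (- x * t) * v t)" if "x > 0" for x
    unfolding v_def using g01 by (intro set_integrable_exp_mult_bounded that \<nu>) auto
  have Psi_eq: "Psi M X \<nu> = laplace_half_line v"
    by (rule ext) (simp add: Psi_def Psi_integrand_def laplace_half_line_def v_def g_def mult.assoc)
  have integrable_Psi: "set_integrable lborel {0<..} (Psi_integrand M X \<nu> x)" if "x > 0" for x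
    using int_v[OF that] by (simp add: Psi_integrand_def[abs_def] v_def g_def mult.assoc)
  have differentiable_Psi: "Psi_deriv M X \<nu> k differentiable at x" if "x > 0" for k x
    unfolding Psi_deriv_def Psi_eq by (rule laplace_half_line_higher_deriv[OF v_meas int_v that])
  define L where "L = laplace_half_line (\<lambda>t. t ^ m * v t)"
  have Psi_deriv: "Psi_deriv M X \<nu> m x = (-1) ^ m * L x" if "x > 0" for x
    unfolding Psi_deriv_def Psi_eq L_def by (rule laplace_half_line_higher_deriv[OF v_meas int_v that])
  have int_L: "set_integrable lborel {0<..} (\<lambda>t. exp (- x * t) * (t ^ m * v t))" if "x > 0" for x
    by (rule laplace_half_line_integrable_power[OF v_meas int_v that])
  \<comment> \<open>The exponent is written \<open>x powr 1\<close> to match the mixture lemmas with \<open>p = 1\<close>.\<close>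
  have L_w: "L x = (\<integral>t. w t * exp (- t * x powr 1) \<partial>lborel)" if "x > 0" for x
    unfolding L_def laplace_half_line_def set_lebesgue_integral_def w_def
    using that by (intro Bochner_Integration.integral_cong) (auto simp: mult_ac)
  have L_nn: "ennreal (L x) = (\<integral>\<^sup>+t. ennreal (w t * exp (- t * x powr 1)) \<partial>lborel)" if "x > 0" for x
  proof -
    have "integrable lborel (\<lambda>t. w t * exp (- t * x powr 1))"
      using int_L[OF that] that unfolding set_integrable_def w_def
      by (simp add: mult_ac)
    then show ?thesis
      unfolding L_w[OF that] using w0 by (intro nn_integral_eq_integral[symmetric]) auto
  qed
  have L0: "L x \<ge> 0" if "x > 0" for x
    unfolding L_w[OF that] using w0 by simp
  have sign: "(-1) ^ m * Psi_deriv M X \<nu> m x = L x" if "x > 0" for x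
    using Psi_deriv[OF that] by (simp flip: mult.assoc power_mult_distrib)

  have J: "J a = ennreal (2 powr (1 - a / 3) / 3 * Gamma (2 * a / 3)) *
        (\<integral>\<^sup>+\<omega>. ennreal (X \<omega> powr (- 2 * a / 3)) \<partial>M)" if "a > 0" for a
    unfolding J_def g_def by (rule nn_integral_laplace_moment[OF M X pos that])

  have lim_L: "((\<lambda>x. ereal (L x)) \<longlongrightarrow> enn2ereal (J (real m + \<nu>))) (at_right 0)"
  proof -
    have "((\<lambda>x. ennreal (L x)) \<longlongrightarrow> (\<integral>\<^sup>+t\<in>{0<..}. ennreal (t ^ m * v t) \<partial>lborel)) (at_right 0)"
      unfolding L_def using g01 int_L by (intro laplace_half_line_tendsto_0) (auto simp: v_def)
    also have "(\<integral>\<^sup>+t\<in>{0<..}. ennreal (t ^ m * v t) \<partial>lborel) = J (real m + \<nu>)"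
      unfolding J_def
      by (intro nn_integral_cong)
         (auto simp: v_def indicator_def powr_add[symmetric] algebra_simps simp flip: powr_realpow)
    finally have "((\<lambda>x. enn2ereal (ennreal (L x))) \<longlongrightarrow> enn2ereal (J (real m + \<nu>))) (at_right 0)"
      by (rule tendsto_enn2erealI)
    then show ?thesis
      by (rule Lim_transform_eventually)
         (auto simp: eventually_at_right_field L0 enn2ereal_ennreal intro!: exI[of _ 1])
  qed
  have neg_one: "(-1 :: ereal) ^ m = ereal ((-1) ^ m)"
    by (simp flip: ereal_power add: one_ereal_def)
  have lim: "((\<lambda>x. ereal (Psi_deriv M X \<nu> m x)) \<longlongrightarrow> (-1) ^ m * enn2ereal (J (real m + \<nu>))) (at_right 0)"
  proof -
    have "((\<lambda>x. ereal ((-1) ^ m) * ereal (L x)) \<longlongrightarrow> ereal ((-1) ^ m) * enn2ereal (J (real m + \<nu>))) (at_right 0)"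
      by (intro tendsto_cmult_ereal lim_L) simp
    then show ?thesis
      unfolding neg_one
      by (rule Lim_transform_eventually)
         (auto simp: eventually_at_right_field Psi_deriv intro!: exI[of _ 1])
  qed
  have Psi_0: "Psi_deriv_0 M X \<nu> m = (-1) ^ m * enn2ereal (J (real m + \<nu>))"
    unfolding Psi_deriv_0_def using lim by (intro tendsto_Lim) auto
  have sign_Psi_0: "(-1) ^ m * Psi_deriv_0 M X \<nu> m = enn2ereal (J (real m + \<nu>))"
  proof -
    have "(-1) ^ m * Psi_deriv_0 M X \<nu> m = ereal ((-1) ^ m * (-1) ^ m) * enn2ereal (J (real m + \<nu>))"
      unfolding Psi_0 neg_one by (simp flip: mult.assoc)
    then show ?thesis by (simp flip: power_mult_distrib one_ereal_def)
  qed

  have lhs: "mellin_lhs M X \<nu> m s = ennreal (Gamma s) * J (real m + \<nu> - s)" if s: "0 < s" for s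
  proof -
    have "mellin_lhs M X \<nu> m s = (\<integral>\<^sup>+x\<in>{0<..}. ennreal (x powr (s - 1)) *
            (\<integral>\<^sup>+t. ennreal (w t * exp (- t * x powr 1)) \<partial>lborel) \<partial>lborel)"
      unfolding mellin_lhs_def
    proof (intro nn_integral_cong)
      fix x :: real
      have "ennreal ((-1) ^ m * (x powr (s - 1) * Psi_deriv M X \<nu> m x))
          = ennreal (x powr (s - 1)) * (\<integral>\<^sup>+t. ennreal (w t * exp (- t * x powr 1)) \<partial>lborel)"
        if "x > 0"
      proof -
        have "(-1) ^ m * (x powr (s - 1) * Psi_deriv M X \<nu> m x) = x powr (s - 1) * L x"
          using sign[OF that] by (simp add: mult.left_commute)
        then show ?thesis
          by (simp only: ennreal_mult' L_nn[OF that, symmetric] powr_ge_zero)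
      qed
      then show "ennreal ((-1) ^ m * (x powr (s - 1) * Psi_deriv M X \<nu> m x)) * indicator {0<..} x
          = ennreal (x powr (s - 1)) * (\<integral>\<^sup>+t. ennreal (w t * exp (- t * x powr 1)) \<partial>lborel) * indicator {0<..} x"
        by (cases "x > 0") auto
    qed
    also have "\<dots> = ennreal (Gamma (s / 1) / 1) * (\<integral>\<^sup>+t. ennreal (w t * t powr (- s / 1)) \<partial>lborel)"
      using w0 wpos s by (intro nn_integral_mellin_laplace lborel.sigma_finite_measure_axioms) auto
    also have "(\<integral>\<^sup>+t. ennreal (w t * t powr (- s / 1)) \<partial>lborel) = J (real m + \<nu> - s)"
      unfolding J_def w_powr by (intro nn_integral_cong) (auto simp: indicator_def)
    finally show ?thesis by simp
  qed
  have mellin: "mellin_lhs M X \<nu> m s = mellin_rhs M X \<nu> m s" if s: "0 < s" "s < real m + \<nu>" for s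
  proof -
    have "Gamma s > 0" using s by simp
    then have "ennreal (Gamma s) * ennreal (2 powr (1 - (real m + \<nu> - s) / 3) / 3 * Gamma (2 * (real m + \<nu> - s) / 3))
      = ennreal (2 powr (1 - (real m + \<nu> - s) / 3) / 3 * Gamma s * Gamma (2 * (real m + \<nu> - s) / 3))"
      by (subst ennreal_mult'[symmetric]) (auto simp: mult_ac)
    then show ?thesis
      using s by (simp add: lhs J mellin_rhs_def mult.assoc[symmetric])
  qed

  have complex: "set_integrable lborel {0<..}
          (\<lambda>x. complex_of_real x powr (s - 1) * complex_of_real (Psi_deriv M X \<nu> m x))
      \<and> integrable M (\<lambda>\<omega>. complex_of_real (X \<omega>) powr (- 2 * (of_nat m + of_real \<nu> - s) / 3))
      \<and> (-1) ^ m * (CLBINT x:{0<..}.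
            complex_of_real x powr (s - 1) * complex_of_real (Psi_deriv M X \<nu> m x))
        = 2 powr (1 - (of_nat m + of_real \<nu> - s) / 3) / 3
          * Gamma s * Gamma (2 * (of_nat m + of_real \<nu> - s) / 3)
          * (\<integral>\<omega>. complex_of_real (X \<omega>) powr (- 2 * (of_nat m + of_real \<nu> - s) / 3) \<partial>M)"
    if fin: "mellin_rhs M X \<nu> m (Re s) < \<infinity>" and s: "0 < Re s" "Re s < real m + \<nu>" for s :: complex
  proof -
    define z where "z = of_nat m + of_real \<nu> - s"
    have Re_z: "Re z = real m + \<nu> - Re s" and z: "Re z > 0"
      using s by (auto simp: z_def)
    \<comment> \<open>The Gamma factors are positive, so a finite right-hand side forces a finite moment.\<close>
    have E: "(\<integral>\<^sup>+\<omega>. ennreal (X \<omega> powr (- 2 * Re z / 3)) \<partial>M) < \<infinity>"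
    proof -
      have "2 powr (1 - Re z / 3) / 3 * Gamma (Re s) * Gamma (2 * Re z / 3) > 0"
        using s z by (intro mult_pos_pos Gamma_real_pos) auto
      then show ?thesis
        using fin by (auto simp: mellin_rhs_def ennreal_mult_less_top Re_z)
    qed
    have "(\<integral>\<^sup>+t. ennreal (w t * t powr (- Re s / 1)) \<partial>lborel) = J (Re z)"
      unfolding J_def w_powr Re_z by (intro nn_integral_cong) (auto simp: indicator_def)
    also have "\<dots> < \<infinity>"
      using E J[OF z] by (simp add: ennreal_mult_less_top)
    finally have fin_w: "(\<integral>\<^sup>+t. ennreal (w t * t powr (- Re s / 1)) \<partial>lborel) < \<infinity>" .
    note mellin_w = integral_mellin_laplace[OF lborel.sigma_finite_measure_axioms _ _ w0 AE_I2[OF wpos] s(1) zero_less_one fin_w]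
    have eq: "complex_of_real x powr (s - 1) * complex_of_real (Psi_deriv M X \<nu> m x)
        = (-1) ^ m * (complex_of_real x powr (s - 1) * of_real (\<integral>t. w t * exp (- t * x powr 1) \<partial>lborel))"
      if "x \<in> {0<..}" for x
      using that by (simp add: Psi_deriv L_w)
    have "set_integrable lborel {0<..} (\<lambda>x. (-1) ^ m *
        (complex_of_real x powr (s - 1) * of_real (\<integral>t. w t * exp (- t * x powr 1) \<partial>lborel)))"
      by (intro set_integrable_mult_right mellin_w(1)) auto
    then have int: "set_integrable lborel {0<..}
          (\<lambda>x. complex_of_real x powr (s - 1) * complex_of_real (Psi_deriv M X \<nu> m x))"
      by (subst set_integrable_cong[OF refl refl eq]) auto
    have sign_sq: "(-1) ^ m * (-1) ^ m = (1::complex)"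
      by (simp flip: power_mult_distrib)
    have w_cpowr: "complex_of_real (w t) * of_real t powr (- s / of_real 1)
        = indicator {0<..} t *\<^sub>R (of_real t powr (z - 1) * of_real (g t))" for t
    proof (cases "t > 0")
      case True
      have "complex_of_real (w t) = of_real (g t) * of_real t powr (of_nat m + of_real \<nu> - 1)"
        using True w_powr[of t 0] powr_of_real[of t "real m + \<nu> - 1"] by simp
      moreover have "complex_of_real t powr (of_nat m + of_real \<nu> - 1) * of_real t powr (- s)
          = of_real t powr (z - 1)"
        by (simp add: z_def algebra_simps flip: powr_add)
      ultimately show ?thesis
        using True by (simp add: mult_ac)
    qed (simp add: w_def)
    have "(-1) ^ m * (CLBINT x:{0<..}. complex_of_real x powr (s - 1) * complex_of_real (Psi_deriv M X \<nu> m x))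
        = (-1) ^ m * (CLBINT x:{0<..}. (-1) ^ m *
            (complex_of_real x powr (s - 1) * of_real (\<integral>t. w t * exp (- t * x powr 1) \<partial>lborel)))"
      by (subst set_lebesgue_integral_cong[OF _ allI[OF impI[OF eq]]]) auto
    also have "\<dots> = (CLBINT x:{0<..}. complex_of_real x powr (s - 1) *
          of_real (\<integral>t. w t * exp (- t * x powr 1) \<partial>lborel))"
      unfolding set_integral_mult_right by (simp only: mult.assoc[symmetric] sign_sq mult_1_left)
    also have "\<dots> = Gamma (s / of_real 1) / of_real 1 *
          (\<integral>t. complex_of_real (w t) * of_real t powr (- s / of_real 1) \<partial>lborel)"
      by (rule mellin_w(3)) simp_all
    also have "\<dots> = Gamma s * (CLBINT t:{0<..}. of_real t powr (z - 1) * of_real (g t))"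
      unfolding w_cpowr set_lebesgue_integral_def by simp
    also have "\<dots> = 2 powr (1 - z / 3) / 3 * Gamma s * Gamma (2 * z / 3) *
          (\<integral>\<omega>. complex_of_real (X \<omega>) powr (- 2 * z / 3) \<partial>M)"
      unfolding g_def integral_laplace_moment(2)[OF M X pos z E] by (simp only: mult_ac)
    finally show ?thesis
      using int integral_laplace_moment(1)[OF M X pos z E] unfolding z_def by (intro conjI)
  qed

  have J_m: "(\<integral>\<^sup>+t\<in>{0<..}. ennreal (laplace_transform M X (sqrt 2 * t powr (3/2))
                                          * t powr (real m + \<nu> - 1)) \<partial>lborel) = J (real m + \<nu>)"
    by (simp add: J_def g_def)
  have exponent: "- 2 * real m / 3 - 2 * \<nu> / 3 = - 2 * (real m + \<nu>) / 3"
    by (simp add: field_simps)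
  have integrable': "\<forall>x>0. set_integrable lborel {0<..} (Psi_integrand M X \<nu> x)"
    and differentiable': "\<forall>k<m. \<forall>x>0. Psi_deriv M X \<nu> k differentiable at x"
    and sign': "\<forall>x>0. (-1) ^ m * Psi_deriv M X \<nu> m x \<ge> 0"
    using integrable_Psi differentiable_Psi sign L0 by simp_all
  have mellin': "\<forall>s. 0 < s \<and> s < real m + \<nu> \<longrightarrow> mellin_lhs M X \<nu> m s = mellin_rhs M X \<nu> m s"
    using mellin by blast
  have J': "J (real m + \<nu>) = ennreal (2 powr (1 - (real m + \<nu>) / 3) / 3 * Gamma (2 * (real m + \<nu>) / 3)) *
      (\<integral>\<^sup>+\<omega>. ennreal (X \<omega> powr (- 2 * (real m + \<nu>) / 3)) \<partial>M)"
    using \<nu> by (intro J) simp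
  show ?thesis
    unfolding J_m exponent
    by (intro conjI integrable' differentiable' sign' lim[folded Psi_0] sign_Psi_0 J' mellin')
       (intro impI allI complex; simp)
qed

end
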